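(* Let $a>0$ and let $q$ be analytic in a neighborhood of the interval $[0,a^{-2}]$. Then the sequence $$\lambda_n=(n+a)^2+q\bigl((n+a)^{-2}\bigr),\qquad n\ge0,$$ is admissible in the sense of Quine--Heydari--Song, provided $\lambda_n>0$ for all $n\ge0$ (in particular, all $\lambda_n$ are real).
   Context: A sequence $(X_k)_{k\ge0}\subset\mathbb{C}\setminus\{0\}$ is admissible in the sense of Quine--Heydari--Song if: (1) $\operatorname{Re}X_k>0$ for every $k$; (2) $\sum_k e^{-X_kt}$ converges absolutely for every $t>0$ and has a full asymptotic expansion as $t\to0^+$ of the form $\sum_k e^{-X_kt}\sim\sum_{\nu\ge0}c_\nu t^{j_\nu}$ with real exponents $j_0<j_1<\cdots$, $j_\nu\to+\infty$ (pure powers, no logarithms); (3) there exists $\beta>0$ with $\lim_{t\to0^+}t^\beta\sum_k e^{-|X_k|t}=0$. *)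

theory Defs
  imports "HOL-Complex_Analysis.Complex_Analysis" "HOL-Library.Landau_Symbols"
begin

text \<open>
  Asymptotic expansions as \<open>t \<rightarrow> 0\<^sup>+\<close> in the sense of Poincare: every remainder is negligible
  compared with the last power retained.  Coefficients may vanish, so finite expansions are
  covered.
\<close>

definition power_expansion_at_0 ::
    "(real \<Rightarrow> complex) \<Rightarrow> (nat \<Rightarrow> complex) \<Rightarrow> (nat \<Rightarrow> real) \<Rightarrow> bool" where
  "power_expansion_at_0 f c j \<longleftrightarrow>
     strict_mono j \<and> filterlim j at_top sequentially \<and>
     (\<forall>N. (\<lambda>t. f t - (\<Sum>\<nu>\<le>N. c \<nu> * of_real (t powr j \<nu>)))
            \<in> o[at_right 0](\<lambda>t. of_real (t powr j N)))"

text \<open>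
  In the last clause the series \<open>\<Sum>k. exp (- norm (X k) * t)\<close> converges by comparison with the
  absolutely convergent series of the second clause, as \<open>Re (X k) \<le> norm (X k)\<close>.
\<close>

definition QHS_admissible :: "(nat \<Rightarrow> complex) \<Rightarrow> bool" where
  "QHS_admissible X \<longleftrightarrow>
     (\<forall>k. X k \<noteq> 0) \<and>
     (\<forall>k. Re (X k) > 0) \<and>
     (\<forall>t>0. summable (\<lambda>k. norm (exp (- X k * of_real t)))) \<and>
     (\<exists>c j. power_expansion_at_0 (\<lambda>t. \<Sum>k. exp (- X k * of_real t)) c j) \<and>
     (\<exists>\<beta>>0. ((\<lambda>t. t powr \<beta> * (\<Sum>k. exp (- norm (X k) * t))) \<longlongrightarrow> (0::real)) (at_right 0))"

end

theory Submission
  imports Defs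
begin

text \<open>
  Put \<open>t = h\<^sup>2\<close> and \<open>x = n + a\<close>. Since \<open>\<lambda>\<^sub>n = x\<^sup>2 + q (x\<^sup>-\<^sup>2)\<close>, expanding \<open>exp (- h\<^sup>2 q)\<close> and then the powers of
  \<open>q\<close> at \<open>0\<close> reduces the theta series to the sums \<open>S\<^sub>k h = (\<Sum>n. x\<^sup>-\<^sup>2\<^sup>k exp (- (h x)\<^sup>2))\<close>: a remainder
  \<open>w\<^sub>n = O (x\<^sup>-\<^sup>2\<^sup>K)\<close> contributes \<open>\<Sum>n. w\<^sub>n exp (- (h x)\<^sup>2)\<close>, where the exponential may be expanded in \<open>h\<close>
  to an order growing with \<open>K\<close>. For \<open>k = 0\<close>, \<open>h S\<^sub>0 h\<close> is a Riemann sum of a Gaussian and has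
  an expansion in powers of \<open>h\<close> as in the Euler-Maclaurin formula. Moreover \<open>S\<^sub>k' = - 2 h S\<^sub>k\<^sub>-\<^sub>1\<close>, so
  the expansions of the other \<open>h S\<^sub>k\<close> follow by integration; as \<open>h S\<^sub>k\<^sub>-\<^sub>1\<close> has no negative powers,
  no logarithm arises. Thus \<open>h\<close> times the theta series is a power series in \<open>h\<close> asymptotically,
  which gives the exponents \<open>(\<nu> - 1) / 2\<close> in \<open>t\<close>.
\<close>

subsection \<open>Expansions up to a fixed order\<close>

text \<open>The polynomial may depend on \<open>M\<close> and its degree is unrestricted, so closure
  under sums, multiples and a change of order is immediate. Coefficients common to all orders are
  extracted only in \<open>poly_asymp_imp_coefficients\<close>. The field is left general because
  the Gaussian sums are treated over the reals and used over the complex numbers.\<close>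

definition poly_asymp :: "nat \<Rightarrow> (real \<Rightarrow> 'a::{real_normed_field}) \<Rightarrow> bool" where
  "poly_asymp M F \<longleftrightarrow>
     (\<exists>p. (\<lambda>h. F h - poly p (of_real h)) \<in> O[at_right 0](\<lambda>h. of_real h ^ M))"

lemma power_bigo_power_at_right_0:
  assumes "m \<le> n"
  shows "(\<lambda>h::real. of_real h ^ n :: 'a::real_normed_field) \<in> O[at_right 0](\<lambda>h. of_real h ^ m)"
proof (rule bigoI[of _ 1])
  have "eventually (\<lambda>h::real. 0 < h \<and> h < 1) (at_right 0)"
    by (intro eventually_at_right_less eventually_conj eventually_at_rightI[of 0 1]) auto
  then show "\<forall>\<^sub>F h in at_right 0. norm (of_real h ^ n :: 'a) \<le> 1 * norm (of_real h ^ m :: 'a)"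
    by eventually_elim (use assms in \<open>auto simp: norm_power intro!: power_decreasing\<close>)
qed

lemma poly_asymp_bigo:
  "F \<in> O[at_right 0](\<lambda>h. of_real h ^ M) \<Longrightarrow> poly_asymp M F"
  unfolding poly_asymp_def by (intro exI[of _ 0]) simp

lemma poly_asymp_poly: "poly_asymp M (\<lambda>h. poly p (of_real h))"
  unfolding poly_asymp_def by (intro exI[of _ p]) simp

lemma poly_asymp_add:
  assumes "poly_asymp M F" "poly_asymp M G"
  shows "poly_asymp M (\<lambda>h. F h + G h)"
proof -
  obtain p q where "(\<lambda>h. F h - poly p (of_real h)) \<in> O[at_right 0](\<lambda>h. of_real h ^ M)"
    and "(\<lambda>h. G h - poly q (of_real h)) \<in> O[at_right 0](\<lambda>h. of_real h ^ M)"
    using assms unfolding poly_asymp_def by blast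
  from sum_in_bigo(1)[OF this] show ?thesis
    unfolding poly_asymp_def by (intro exI[of _ "p + q"]) (simp add: algebra_simps)
qed

lemma poly_asymp_sum:
  "(\<And>i. i \<in> A \<Longrightarrow> poly_asymp M (F i)) \<Longrightarrow> poly_asymp M (\<lambda>h. \<Sum>i\<in>A. F i h)"
proof (induction A rule: infinite_finite_induct)
  case (insert x A)
  then show ?case by (simp add: poly_asymp_add)
qed (use poly_asymp_poly[of M 0] in simp_all)

text \<open>The gain of \<open>k\<close> orders drives the induction for Riemann sums below; with
  \<open>k = 0\<close> this is multiplication by a scalar.\<close>

lemma poly_asymp_mult_power:
  assumes "poly_asymp M F"
  shows "poly_asymp (k + M) (\<lambda>h. c * of_real h ^ k * F h)"
proof -
  obtain p where "(\<lambda>h. F h - poly p (of_real h)) \<in> O[at_right 0](\<lambda>h. of_real h ^ M)"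
    using assms unfolding poly_asymp_def by blast
  then have "(\<lambda>h. c * (of_real h ^ k * (F h - poly p (of_real h))))
      \<in> O[at_right 0](\<lambda>h. of_real h ^ k * of_real h ^ M)"
    by (cases "c = 0") (auto intro: landau_o.big.mult)
  then show ?thesis
    unfolding poly_asymp_def
    by (intro exI[of _ "monom c k * p"]) (simp add: algebra_simps power_add poly_monom)
qed

lemma poly_asymp_mono:
  assumes "poly_asymp N F" "M \<le> N"
  shows "poly_asymp M F"
proof -
  obtain p where "(\<lambda>h. F h - poly p (of_real h)) \<in> O[at_right 0](\<lambda>h. of_real h ^ N)"
    using assms(1) unfolding poly_asymp_def by blast
  from landau_o.big_trans[OF this power_bigo_power_at_right_0[OF assms(2)]]
  show ?thesis
    unfolding poly_asymp_def by blast
qed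

lemma poly_asymp_cong:
  assumes "poly_asymp M F" "\<And>h. h > 0 \<Longrightarrow> F h = G h"
  shows "poly_asymp M G"
proof -
  obtain p where "(\<lambda>h. F h - poly p (of_real h)) \<in> O[at_right 0](\<lambda>h. of_real h ^ M)"
    using assms unfolding poly_asymp_def by blast
  moreover have "\<forall>\<^sub>F h in at_right 0. F h - poly p (of_real h) = G h - poly p (of_real h)"
    using assms(2) by (auto intro!: eventually_at_rightI[of 0 1])
  ultimately have "(\<lambda>h. G h - poly p (of_real h)) \<in> O[at_right 0](\<lambda>h. of_real h ^ M)"
    by (rule landau_o.big.in_cong[THEN iffD1, rotated])
  then show ?thesis
    unfolding poly_asymp_def by blast
qed

lemma poly_asymp_of_real:
  assumes "poly_asymp M F"
  shows "poly_asymp M (\<lambda>h. of_real (F h) :: 'a::real_normed_field)"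
proof -
  obtain p where p: "(\<lambda>h. F h - poly p h) \<in> O[at_right 0](\<lambda>h. h ^ M)"
    using assms unfolding poly_asymp_def by auto
  have "poly (map_poly of_real p) (of_real h) = (of_real (poly p h) :: 'a)" for h
    by (induction p) (simp_all add: map_poly_pCons)
  moreover have "(\<lambda>h. of_real (F h - poly p h)) \<in> O[at_right 0](\<lambda>h. of_real (h ^ M) :: 'a)"
    using p by (subst landau_o.big.of_real_iff)
  ultimately have "(\<lambda>h. of_real (F h) - poly (map_poly of_real p) (of_real h))
      \<in> O[at_right 0](\<lambda>h. of_real h ^ M :: 'a)"
    by simp
  then show ?thesis
    unfolding poly_asymp_def by blast
qed

text \<open>Letting h tend to 0 shows that the constant coefficient vanishes; after cancelling one
  factor h, the quotient satisfies the same hypothesis with \<open>M\<close> lowered by one.\<close>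

lemma poly_bigo_power_imp_coeff_eq_0:
  fixes r :: "'a::real_normed_field poly"
  assumes "(\<lambda>h. poly r (of_real h)) \<in> O[at_right 0](\<lambda>h. of_real h ^ M)" "i < M"
  shows "coeff r i = 0"
  using assms
proof (induction M arbitrary: r i)
  case 0
  from 0(2) show ?case by simp
next
  case (Suc M)
  obtain c s where r: "r = pCons c s" by (cases r)
  have "((\<lambda>h::real. of_real h ^ Suc M :: 'a) \<longlongrightarrow> of_real 0 ^ Suc M) (at_right 0)"
    by (intro tendsto_intros)
  then have "(\<lambda>h. of_real h ^ Suc M :: 'a) \<in> o[at_right 0](\<lambda>_. 1)"
    by (intro smalloI_tendsto) auto
  from landau_o.big_small_trans[OF Suc.prems(1) this]
  have "((\<lambda>h. poly r (of_real h)) \<longlongrightarrow> 0) (at_right 0)"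
    by (auto dest: smalloD_tendsto)
  moreover have "((\<lambda>h. poly r (of_real h)) \<longlongrightarrow> poly r (of_real 0)) (at_right 0)"
    by (intro tendsto_intros)
  ultimately have c: "c = 0"
    using tendsto_unique[of "at_right (0::real)"] r by (fastforce simp: trivial_limit_at_right_real)
  have nz: "\<forall>\<^sub>F h in at_right 0. (of_real h :: 'a) \<noteq> 0"
    by (auto intro!: eventually_at_rightI[of 0 1])
  have "(\<lambda>h. of_real h * poly s (of_real h))
      \<in> O[at_right 0](\<lambda>h. of_real h * of_real h ^ M)"
    using Suc.prems(1) c r by simp
  then have "(\<lambda>h. poly s (of_real h)) \<in> O[at_right 0](\<lambda>h. of_real h ^ M)"
    by (subst (asm) landau_o.big.mult_cancel_left[OF bigtheta_refl nz])
  from Suc.IH[OF this] have "coeff s j = 0" if "j < M" for j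
    using that by simp
  with Suc.prems(2) show ?case
    unfolding r c by (cases i) simp_all
qed

lemma poly_minus_truncation_bigo:
  fixes p :: "'a::real_normed_field poly"
  shows "(\<lambda>h. poly p (of_real h) - (\<Sum>\<nu><N. coeff p \<nu> * of_real h ^ \<nu>))
    \<in> O[at_right 0](\<lambda>h. of_real h ^ N)"
proof (induction N arbitrary: p)
  case 0
  have "((\<lambda>h. poly p (of_real h)) \<longlongrightarrow> poly p (of_real 0)) (at_right 0)"
    by (intro tendsto_intros)
  then show ?case
    by (auto intro!: bigoI_tendsto)
next
  case (Suc N)
  obtain c s where p: "p = pCons c s" by (cases p)
  have eq: "(\<lambda>h. poly p (of_real h) - (\<Sum>\<nu><Suc N. coeff p \<nu> * of_real h ^ \<nu>))
      = (\<lambda>h. of_real h * (poly s (of_real h) - (\<Sum>\<nu><N. coeff s \<nu> * of_real h ^ \<nu>)))"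
    unfolding p by (subst sum.lessThan_Suc_shift) (simp add: algebra_simps sum_distrib_left)
  show ?case
    unfolding eq power_Suc by (rule landau_o.big.mult[OF landau_o.big_refl Suc.IH])
qed

text \<open>The difference of two approximating polynomials is small to the lower of their orders,
  so they share all coefficients below it. A diagonal choice therefore gives one sequence that
  serves every order.\<close>

lemma poly_asymp_imp_coefficients:
  fixes F :: "real \<Rightarrow> 'a::real_normed_field"
  assumes "\<And>M. poly_asymp M F"
  obtains c where "\<And>N. (\<lambda>h. F h - (\<Sum>\<nu><N. c \<nu> * of_real h ^ \<nu>))
    \<in> O[at_right 0](\<lambda>h. of_real h ^ N)"
proof -
  obtain p where p: "\<And>M. (\<lambda>h. F h - poly (p M) (of_real h)) \<in> O[at_right 0](\<lambda>h. of_real h ^ M)"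
    using assms unfolding poly_asymp_def by metis
  \<comment> \<open>Order \<open>Suc \<nu>\<close> is the least one that determines the coefficient
    of index \<nu>.\<close>
  define c where "c \<nu> = coeff (p (Suc \<nu>)) \<nu>" for \<nu>
  have c: "c \<nu> = coeff (p N) \<nu>" if "\<nu> < N" for \<nu> N
  proof -
    have "(\<lambda>h. F h - poly (p N) (of_real h)) \<in> O[at_right 0](\<lambda>h. of_real h ^ Suc \<nu>)"
      by (rule landau_o.big_trans[OF p power_bigo_power_at_right_0]) (use that in simp)
    from sum_in_bigo(2)[OF this p[of "Suc \<nu>"]]
    have "(\<lambda>h. poly (p (Suc \<nu>) - p N) (of_real h)) \<in> O[at_right 0](\<lambda>h. of_real h ^ Suc \<nu>)"
      by simp
    from poly_bigo_power_imp_coeff_eq_0[OF this, of \<nu>] show ?thesis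
      by (simp add: c_def)
  qed
  have "(\<lambda>h. F h - (\<Sum>\<nu><N. c \<nu> * of_real h ^ \<nu>)) \<in> O[at_right 0](\<lambda>h. of_real h ^ N)" for N
    using sum_in_bigo(1)[OF p[of N] poly_minus_truncation_bigo[of "p N" N]]
    by (simp add: c algebra_simps)
  then show ?thesis by (rule that)
qed

subsection \<open>Riemann sums of functions with decaying derivatives\<close>

text \<open>A geometric series with ratio \<open>exp (- h)\<close>, where
  \<open>1 - exp (- h)\<close> is at least \<open>h / (1 + h)\<close>. The factor h makes the bound
  uniform as h tends to 0.\<close>

lemma sum_exp_arith_progression:
  fixes a h :: real
  assumes "a \<ge> 0" "h > 0"
  shows "summable (\<lambda>n. exp (- (h * (real n + a))))"
    and "h * (\<Sum>n. exp (- (h * (real n + a)))) \<le> 1 + h"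
proof -
  have eq: "exp (- (h * (real n + a))) = exp (- (h * a)) * exp (- h) ^ n" for n
    by (simp add: algebra_simps flip: exp_of_nat_mult exp_add)
  have lt: "norm (exp (- h)) < 1"
    using assms by simp
  show "summable (\<lambda>n. exp (- (h * (real n + a))))"
    unfolding eq by (intro summable_mult summable_geometric lt)
  have "exp (- h) \<le> 1 / (1 + h)"
    using exp_ge_add_one_self[of h] assms by (simp add: exp_minus field_simps)
  then have "h / (1 + h) \<le> 1 - exp (- h)"
    using assms by (simp add: field_simps)
  then have "h \<le> (1 + h) * (1 - exp (- h))"
    using assms by (simp add: field_simps)
  then have "h / (1 - exp (- h)) \<le> 1 + h"
    using assms by (simp add: pos_divide_le_eq)
  moreover have "exp (- (h * a)) * (h / (1 - exp (- h))) \<le> 1 * (h / (1 - exp (- h)))"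
    using assms by (intro mult_right_mono) auto
  moreover have "h * (\<Sum>n. exp (- (h * (real n + a)))) = exp (- (h * a)) * (h / (1 - exp (- h)))"
    unfolding eq using suminf_geometric[OF lt] summable_geometric[OF lt] by (simp add: suminf_mult)
  ultimately show "h * (\<Sum>n. exp (- (h * (real n + a)))) \<le> 1 + h"
    by linarith
qed

lemma bounded_at_right_0_bigo:
  fixes F :: "real \<Rightarrow> 'a::real_normed_field"
  assumes "\<And>h. 0 < h \<Longrightarrow> h \<le> 1 \<Longrightarrow> norm (F h) \<le> C * h ^ M"
  shows "F \<in> O[at_right 0](\<lambda>h. of_real h ^ M)"
  by (rule bigoI[of _ C], rule eventually_at_rightI[of 0 1]) (use assms in \<open>auto simp: norm_power\<close>)

text \<open>Decay is imposed only from the first derivative on, and \<open>D 0\<close> merely has a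
  limit: in the application \<open>D 0\<close> is a primitive of the Gaussian and \<open>D 1\<close>
  the Gaussian itself.\<close>

locale decaying_derivatives =
  fixes D :: "nat \<Rightarrow> real \<Rightarrow> real" and a :: real
  assumes a: "a > 0"
    and deriv: "(D j has_real_derivative D (Suc j) y) (at y)"
    and bound: "\<exists>C. \<forall>y\<ge>0. \<bar>D (Suc j) y\<bar> \<le> C * exp (- y)"
    and lim: "\<exists>L. (D j \<longlongrightarrow> L) at_top"
begin

lemma summable_samples:
  assumes "h > 0"
  shows "summable (\<lambda>n. D (Suc j) (h * (real n + a)))"
proof -
  obtain C where "\<And>y. y \<ge> 0 \<Longrightarrow> \<bar>D (Suc j) y\<bar> \<le> C * exp (- y)"
    using bound by blast
  then show ?thesis
    using assms a
    by (intro summable_comparison_test'[OF summable_mult[of _ C,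
          OF sum_exp_arith_progression(1)[OF less_imp_le[OF a] assms]]]) auto
qed

lemma taylor:
  assumes "h > 0" "N > 0"
  obtains t where "y < t" "t < y + h"
    "D j (y + h) = (\<Sum>i<N. D (i + j) y / fact i * h ^ i) + D (N + j) t / fact N * h ^ N"
  using Taylor[of N "\<lambda>i. D (i + j)" "D j" y "y + h" y "y + h"] assms deriv by auto

text \<open>Taylor expansion at 0. For positive \<open>M\<close> the Lagrange remainder involves a
  derivative of positive index, which is bounded on the half-line; for \<open>M = 0\<close>
  continuity at 0 suffices.\<close>

lemma poly_asymp_at_a: "poly_asymp M (\<lambda>h. D j (h * a))"
proof (cases M)
  case 0
  have "isCont (D j) y" for y
    using deriv DERIV_isCont by blast
  then have "((\<lambda>h. D j (h * a)) \<longlongrightarrow> D j (0 * a)) (at_right 0)"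
    by (intro isCont_tendsto_compose[of _ "D j"] tendsto_intros)
  then have "(\<lambda>h. D j (h * a)) \<in> O[at_right 0](\<lambda>_. 1)"
    by (intro bigoI_tendsto) auto
  with 0 show ?thesis
    by (intro poly_asymp_bigo) simp
next
  case (Suc N)
  obtain C where C: "\<And>y. y \<ge> 0 \<Longrightarrow> \<bar>D (Suc (N + j)) y\<bar> \<le> C * exp (- y)"
    using bound by blast
  define p where "p = (\<Sum>i<M. monom (D (i + j) 0 / fact i * a ^ i) i)"
  have "\<bar>D j (h * a) - poly p h\<bar> \<le> C * a ^ M * h ^ M" if h: "h > 0" for h
  proof -
    obtain t where t: "0 < t"
      and eq: "D j (h * a) = (\<Sum>i<M. D (i + j) 0 / fact i * (h * a) ^ i)
        + D (M + j) t / fact M * (h * a) ^ M"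
      using taylor[of "h * a" M 0 j] h a Suc by auto
    have "\<bar>D (M + j) t\<bar> \<le> C * exp (- t)"
      using C[of t] t Suc by simp
    moreover have "0 \<le> C" using C[of 0] by simp
    ultimately have "\<bar>D (M + j) t\<bar> \<le> C"
      using t by (smt (verit) exp_le_one_iff mult_left_le)
    then have "\<bar>D (M + j) t\<bar> / fact M \<le> C / 1"
      by (intro frac_le) (auto simp: fact_ge_1)
    then have "\<bar>D (M + j) t\<bar> / fact M * (h * a) ^ M \<le> C / 1 * (h * a) ^ M"
      using h a by (intro mult_right_mono) auto
    then have "\<bar>D (M + j) t / fact M * (h * a) ^ M\<bar> \<le> C * (h * a) ^ M"
      using h a by (simp add: abs_mult)
    moreover have "poly p h = (\<Sum>i<M. D (i + j) 0 / fact i * (h * a) ^ i)"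
      by (simp add: p_def poly_sum poly_monom power_mult_distrib mult_ac)
    ultimately show ?thesis
      unfolding eq by (simp add: power_mult_distrib mult_ac)
  qed
  then have "(\<lambda>h. D j (h * a) - poly p h) \<in> O[at_right 0](\<lambda>h. of_real h ^ M)"
    by (intro bounded_at_right_0_bigo[of _ "C * a ^ M"]) auto
  then show ?thesis
    unfolding poly_asymp_def by auto
qed

text \<open>Summing the Taylor expansion of \<open>D j (y + h) - D j y\<close> over the sample points, the left hand
  side telescopes and the term of order one is the sum to be expanded; the terms of higher
  order are sums of the same kind, multiplied by a positive power of \<open>h\<close>.\<close>

lemma poly_asymp_riemann_sum:
  "poly_asymp M (\<lambda>h. h * (\<Sum>n. D (Suc j) (h * (real n + a))))"
proof (induction M arbitrary: j)
  case 0
  obtain C where C: "\<And>y. y \<ge> 0 \<Longrightarrow> \<bar>D (Suc j) y\<bar> \<le> C * exp (- y)"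
    using bound by blast
  have "0 \<le> C" using C[of 0] by simp
  \<comment> \<open>The constant 2 bounds \<open>1 + h\<close> for h at most 1.\<close>
  have "\<bar>h * (\<Sum>n. D (Suc j) (h * (real n + a)))\<bar> \<le> (2 * C) * h ^ 0" if h: "0 < h" "h \<le> 1" for h
  proof -
    note s = sum_exp_arith_progression[OF less_imp_le[OF a] h(1)]
    have "\<bar>\<Sum>n. D (Suc j) (h * (real n + a))\<bar> \<le> (\<Sum>n. C * exp (- (h * (real n + a))))"
      unfolding real_norm_def[symmetric]
      by (rule norm_suminf_le) (use C h a s in \<open>auto intro: summable_mult simp: less_imp_le\<close>)
    also have "\<dots> = C * (\<Sum>n. exp (- (h * (real n + a))))"
      by (rule suminf_mult[OF s(1)])
    finally have "\<bar>h * (\<Sum>n. D (Suc j) (h * (real n + a)))\<bar>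
        \<le> C * (h * (\<Sum>n. exp (- (h * (real n + a)))))"
      using h by (simp add: abs_mult mult_left_mono mult.left_commute)
    also have "\<dots> \<le> C * 2"
      using s(2) h \<open>0 \<le> C\<close> by (intro mult_left_mono) auto
    finally show ?thesis by simp
  qed
  then show ?case
    by (intro poly_asymp_bigo bounded_at_right_0_bigo) auto
next
  case (Suc M)
  obtain C where C: "\<And>y. y \<ge> 0 \<Longrightarrow> \<bar>D (Suc (Suc (M + j))) y\<bar> \<le> C * exp (- y)"
    using bound[of "Suc (M + j)"] by auto
  have "0 \<le> C" using C[of 0] by simp
  obtain L where L: "(D j \<longlongrightarrow> L) at_top"
    using lim by blast
  \<comment> \<open>\<open>L - D j (h * a)\<close> is the telescoped sum. The index k stands for the
    Taylor term of order \<open>k + 2\<close>: one of its powers of h is kept with the inner sum, to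
    match the induction hypothesis, and \<open>Suc k\<close> powers remain in front.\<close>
  define E where "E h = L - D j (h * a)
    - (\<Sum>k<M. h ^ Suc k / fact (k + 2) * (h * (\<Sum>n. D (Suc (Suc (k + j))) (h * (real n + a)))))
    - h * (\<Sum>n. D (Suc j) (h * (real n + a)))" for h
  have E: "\<bar>E h\<bar> \<le> (2 * C) * h ^ Suc M" if h: "0 < h" "h \<le> 1" for h
  proof -
    define y where "y n = h * (real n + a)" for n
    have y: "y n > 0" "y (Suc n) = y n + h" for n
      using h a by (simp_all add: y_def algebra_simps add_pos_nonneg)
    define e where "e n = D j (y (Suc n)) - D j (y n)
      - (\<Sum>k<M. h ^ Suc k / fact (k + 2) * (h * D (Suc (Suc (k + j))) (y n)))
      - h * D (Suc j) (y n)" for n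
    have "filterlim (\<lambda>n. h * (real n + a)) at_top sequentially"
      using h by real_asymp
    then have "(\<lambda>n. D j (y n)) \<longlonglongrightarrow> L"
      unfolding y_def by (rule filterlim_compose[OF L])
    then have telescope: "(\<lambda>n. D j (y (Suc n)) - D j (y n)) sums (L - D j (y 0))"
      by (rule telescope_sums)
    have y0: "h * a = y 0"
      by (simp add: y_def)
    have "e sums E h"
      unfolding e_def E_def y0 unfolding y_def[symmetric]
      by (intro sums_diff[OF sums_diff[OF telescope]] sums_sum sums_mult summable_sums)
        (simp_all add: y_def summable_samples h)
    \<comment> \<open>\<open>e n\<close> is a Lagrange remainder of order \<open>M + 2\<close> whose
      intermediate point lies to the right of \<open>y n\<close>, so its decay is at least that at
      \<open>y n\<close>.\<close>
    have e: "\<bar>e n\<bar> \<le> C * h ^ (M + 2) * exp (- y n)" for n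
    proof -
      obtain t where t: "y n < t"
        and eq: "D j (y n + h) = (\<Sum>i<M + 2. D (i + j) (y n) / fact i * h ^ i)
          + D (M + 2 + j) t / fact (M + 2) * h ^ (M + 2)"
        using taylor[of h "M + 2" "y n" j] h by auto
      have "(\<Sum>i<M + 2. D (i + j) (y n) / fact i * h ^ i) = D j (y n) + h * D (Suc j) (y n)
        + (\<Sum>k<M. h ^ Suc k / fact (k + 2) * (h * D (Suc (Suc (k + j))) (y n)))"
        by (simp add: sum.lessThan_Suc_shift del: sum.lessThan_Suc fact_Suc)
          (intro sum.cong refl, simp add: mult_ac del: fact_Suc)
      then have "e n = D (M + 2 + j) t / fact (M + 2) * h ^ (M + 2)"
        unfolding e_def y(2) eq by simp
      also have "\<bar>\<dots>\<bar> = \<bar>D (M + 2 + j) t\<bar> / fact (M + 2) * h ^ (M + 2)"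
        using h by (simp add: abs_mult del: fact_Suc)
      also have "\<dots> \<le> (C * exp (- y n)) / 1 * h ^ (M + 2)"
      proof (intro mult_right_mono frac_le)
        have "\<bar>D (M + 2 + j) t\<bar> \<le> C * exp (- t)"
          using C[of t] t y(1)[of n] by simp
        also have "\<dots> \<le> C * exp (- y n)"
          using t \<open>0 \<le> C\<close> by (intro mult_left_mono) auto
        finally show "\<bar>D (M + 2 + j) t\<bar> \<le> C * exp (- y n)" .
      qed (use h \<open>0 \<le> C\<close> in \<open>auto simp: fact_ge_1 simp del: fact_Suc\<close>)
      finally show ?thesis by (simp add: mult_ac)
    qed
    note s = sum_exp_arith_progression[OF less_imp_le[OF a] h(1), folded y_def]
    have "\<bar>suminf e\<bar> \<le> (\<Sum>n. C * h ^ (M + 2) * exp (- y n))"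
      unfolding real_norm_def[symmetric]
      by (rule norm_suminf_le) (use e s(1) in \<open>auto intro: summable_mult\<close>)
    \<comment> \<open>One of the \<open>M + 2\<close> powers of h pays for the sum over n, which
      leaves order \<open>Suc M\<close>.\<close>
    also have "\<dots> = C * h ^ Suc M * (h * (\<Sum>n. exp (- y n)))"
      by (subst suminf_mult[OF s(1)]) simp
    also have "\<dots> \<le> C * h ^ Suc M * 2"
      using s(2) h \<open>0 \<le> C\<close> by (intro mult_left_mono) auto
    finally show ?thesis
      using \<open>e sums E h\<close> by (simp add: sums_iff mult_ac)
  qed
  have "poly_asymp (Suc M) E"
    by (intro poly_asymp_bigo bounded_at_right_0_bigo[of _ "2 * C"]) (use E in auto)
  from poly_asymp_mult_power[OF this, where c = "- 1" and k = 0] have minus_E: "poly_asymp (Suc M) (\<lambda>h. - E h)"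
    by simp
  from poly_asymp_mult_power[OF poly_asymp_at_a[of "Suc M" j], where c = "- 1" and k = 0]
  have minus_D: "poly_asymp (Suc M) (\<lambda>h. - D j (h * a))"
    by simp
  \<comment> \<open>The induction hypothesis is applied to the higher derivative index
    \<open>Suc (k + j)\<close>; the prefactor raises its order \<open>M\<close> by
    \<open>Suc k\<close>, hence at least to \<open>Suc M\<close>.\<close>
  have "poly_asymp (Suc M)
      (\<lambda>h. - 1 / fact (k + 2) * of_real h ^ Suc k * (h * (\<Sum>n. D (Suc (Suc (k + j))) (h * (real n + a)))))"
    for k
    by (rule poly_asymp_mono[OF poly_asymp_mult_power[OF Suc.IH]]) simp
  then have "poly_asymp (Suc M) (\<lambda>h. \<Sum>k<M.
      - 1 / fact (k + 2) * of_real h ^ Suc k * (h * (\<Sum>n. D (Suc (Suc (k + j))) (h * (real n + a)))))"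
    by (rule poly_asymp_sum)
  from poly_asymp_add[OF poly_asymp_add[OF poly_asymp_poly[of _ "[:L:]"] minus_D]
      poly_asymp_add[OF this minus_E]]
  show ?case
    by (rule poly_asymp_cong) (simp add: E_def sum_negf del: fact_Suc)
qed

end

subsection \<open>Gaussian sums\<close>

text \<open>Up to the sign \<open>(- 1) ^ j\<close> these are the Hermite polynomials: the
  polynomial factors in the derivatives of \<open>exp (- y\<^sup>2)\<close>.\<close>

primrec gauss_deriv_poly :: "nat \<Rightarrow> real poly" where
  "gauss_deriv_poly 0 = 1"
| "gauss_deriv_poly (Suc j) = pderiv (gauss_deriv_poly j) - [:0, 2:] * gauss_deriv_poly j"

lemma deriv_gauss_deriv_poly:
  "((\<lambda>y. poly (gauss_deriv_poly j) y * exp (- y\<^sup>2)) has_real_derivative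
     poly (gauss_deriv_poly (Suc j)) y * exp (- y\<^sup>2)) (at y)"
  by (auto intro!: derivative_eq_intros poly_DERIV simp: algebra_simps)

lemma minus_square_le: "- y\<^sup>2 \<le> 1 - (y::real)"
  using zero_le_power2[of "y - 1 / 2"] by (simp add: power2_eq_square algebra_simps)

text \<open>Each power \<open>y ^ k\<close> is at most \<open>fact k * exp y\<close>, so the
  polynomial costs one factor \<open>exp y\<close>; the inequality
  \<open>y - y\<^sup>2 \<le> 1 - y\<close>, that is \<open>(y - 1)\<^sup>2 \<ge> 0\<close>, absorbs
  it.\<close>

lemma poly_times_gauss_bound:
  fixes p :: "real poly"
  shows "\<exists>C. \<forall>y\<ge>0. \<bar>poly p y * exp (- y\<^sup>2)\<bar> \<le> C * exp (- y)"
proof (intro exI allI impI)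
  fix y :: real assume y: "y \<ge> 0"
  have pow: "y ^ k \<le> fact k * exp y" for k
  proof -
    \<comment> \<open>A single term of the exponential series is bounded by the whole
      series.\<close>
    have "y ^ k /\<^sub>R fact k \<le> exp y"
      unfolding exp_def
      using sum_le_suminf[OF summable_exp_generic, of "{k}" y] y by simp
    then show ?thesis by (simp add: field_simps)
  qed
  have "\<bar>poly p y\<bar> \<le> (\<Sum>i\<le>degree p. \<bar>coeff p i * y ^ i\<bar>)"
    unfolding poly_altdef by (rule sum_abs)
  also have "\<dots> \<le> (\<Sum>i\<le>degree p. \<bar>coeff p i\<bar> * (fact i * exp y))"
    using y pow by (intro sum_mono) (simp add: abs_mult mult_left_mono)
  also have "\<dots> = (\<Sum>i\<le>degree p. \<bar>coeff p i\<bar> * fact i) * exp y"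
    by (simp add: sum_distrib_left mult_ac)
  finally have "\<bar>poly p y\<bar> \<le> (\<Sum>i\<le>degree p. \<bar>coeff p i\<bar> * fact i) * exp y" .
  then have "\<bar>poly p y * exp (- y\<^sup>2)\<bar>
      \<le> (\<Sum>i\<le>degree p. \<bar>coeff p i\<bar> * fact i) * exp y * exp (- y\<^sup>2)"
    by (simp add: abs_mult mult_right_mono)
  also have "\<dots> = (\<Sum>i\<le>degree p. \<bar>coeff p i\<bar> * fact i) * exp (y - y\<^sup>2)"
    by (simp add: mult_ac flip: exp_add)
  also have "y - y\<^sup>2 \<le> 1 - y"
    using zero_le_power2[of "y - 1"] by (simp add: power2_eq_square algebra_simps)
  then have "(\<Sum>i\<le>degree p. \<bar>coeff p i\<bar> * fact i) * exp (y - y\<^sup>2)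
      \<le> (\<Sum>i\<le>degree p. \<bar>coeff p i\<bar> * fact i) * exp (1 - y)"
    by (intro mult_left_mono sum_nonneg) auto
  also have "\<dots> = (\<Sum>i\<le>degree p. \<bar>coeff p i\<bar> * fact i) * exp 1 * exp (- y)"
    by (simp flip: exp_add)
  finally show "\<bar>poly p y * exp (- y\<^sup>2)\<bar>
      \<le> (\<Sum>i\<le>degree p. \<bar>coeff p i\<bar> * fact i) * exp 1 * exp (- y)" .
qed

section \<open>A bounded primitive of the Gaussian\<close>

lemma mono_bdd_above_tendsto_at_top:
  fixes f :: "real \<Rightarrow> real"
  assumes "mono f" "bdd_above (range f)"
  shows "(f \<longlongrightarrow> (SUP x. f x)) at_top"
proof (rule order_tendstoI)
  fix l assume "l < (SUP x. f x)"
  then obtain x where "l < f x"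
    using less_cSUP_iff[of UNIV f l] assms(2) by auto
  then show "\<forall>\<^sub>F x in at_top. l < f x"
    by (intro eventually_at_top_linorderI[of x]) (rule less_le_trans, assumption, rule monoD[OF assms(1)])
next
  fix u assume "(SUP x. f x) < u"
  then show "\<forall>\<^sub>F x in at_top. f x < u"
    by (intro always_eventually allI) (rule le_less_trans[OF cSUP_upper[OF UNIV_I assms(2)]])
qed

text \<open>The entire function \<open>exp (- z\<^sup>2)\<close> has a holomorphic primitive, whose
  real part on the real line is \<open>G\<close>. As \<open>G\<close> is increasing and bounded
  above, it has a limit.\<close>

lemma gauss_primitive:
  obtains G :: "real \<Rightarrow> real" and L where "\<And>y. (G has_real_derivative exp (- y\<^sup>2)) (at y)"
    and "(G \<longlongrightarrow> L) at_top"
proof -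
  have "(\<lambda>z::complex. exp (- z\<^sup>2)) holomorphic_on UNIV"
    by (intro holomorphic_intros)
  then obtain g where g: "\<And>z::complex. (g has_field_derivative exp (- z\<^sup>2)) (at z)"
    using holomorphic_convex_primitive'[of UNIV] by auto
  define G where "G y = Re (g (of_real y))" for y
  have deriv: "(G has_real_derivative exp (- y\<^sup>2)) (at y)" for y
  proof -
    have "((\<lambda>y. g (of_real y)) has_vector_derivative exp (- (of_real y)\<^sup>2)) (at y)"
      using has_vector_derivative_real_field[OF g] by simp
    then have "(G has_vector_derivative Re (exp (- (of_real y)\<^sup>2))) (at y)"
      unfolding G_def by (rule bounded_linear.has_vector_derivative[OF bounded_linear_Re])
    moreover have "exp (- (complex_of_real y)\<^sup>2) = of_real (exp (- y\<^sup>2))"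
      by (simp add: exp_of_real[symmetric])
    ultimately show ?thesis
      by (simp add: has_real_derivative_iff_has_vector_derivative)
  qed
  have mono: "mono G"
    using deriv by (intro monoI DERIV_nonneg_imp_nondecreasing[of _ _ G]) force+
  have "G y \<le> G 0 + exp 1" for y
  proof (cases "y \<ge> 0")
    case True
    \<comment> \<open>The added term \<open>exp (1 - y)\<close> makes the function decreasing, since
      its derivative \<open>- exp (1 - y)\<close> outweighs the Gaussian; this bounds
      \<open>G\<close> by its value at 0 plus \<open>exp 1\<close>.\<close>
    have "G y + exp (1 - y) \<le> G 0 + exp (1 - 0)"
    proof (rule DERIV_nonpos_imp_nonincreasing[OF True])
      fix x :: real
      note minus_square_le[of x]
      moreover have "((\<lambda>y. G y + exp (1 - y)) has_real_derivative exp (- x\<^sup>2) - exp (1 - x)) (at x)"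
        by (auto intro!: derivative_eq_intros deriv)
      ultimately show "\<exists>d. ((\<lambda>y. G y + exp (1 - y)) has_real_derivative d) (at x) \<and> d \<le> 0"
        by (intro exI[of _ "exp (- x\<^sup>2) - exp (1 - x)"]) simp
    qed
    with exp_gt_zero[of "1 - y"] show ?thesis
      by (simp only: diff_zero)
  next
    case False
    then have "G y \<le> G 0" by (intro monoD[OF mono]) simp
    then show ?thesis using exp_gt_zero[of "1::real"] by linarith
  qed
  then have "bdd_above (range G)"
    by (intro bdd_aboveI2)
  from that[OF deriv mono_bdd_above_tendsto_at_top[OF mono this]] show ?thesis .
qed

lemma poly_asymp_gauss_sum:
  fixes a :: real
  assumes "a > 0"
  shows "poly_asymp M (\<lambda>h. h * (\<Sum>n. exp (- (h * (real n + a))\<^sup>2)))"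
proof -
  obtain G L where G: "\<And>y::real. (G has_real_derivative exp (- y\<^sup>2)) (at y)"
    and L: "(G \<longlongrightarrow> L) at_top"
    using gauss_primitive by blast
  \<comment> \<open>The primitive takes index 0, so the Gaussian sum is the Riemann sum of
    \<open>D (Suc 0)\<close>.\<close>
  define D where "D j = (case j of 0 \<Rightarrow> G
    | Suc i \<Rightarrow> (\<lambda>y. poly (gauss_deriv_poly i) y * exp (- y\<^sup>2)))" for j
  interpret decaying_derivatives D a
  proof
    show "(D j has_real_derivative D (Suc j) y) (at y)" for j y
    proof (cases j)
      case 0
      then show ?thesis by (simp add: D_def G)
    next
      case (Suc i)
      then show ?thesis
        using deriv_gauss_deriv_poly[of i y] by (simp add: D_def del: gauss_deriv_poly.simps)
    qed
    show bound: "\<exists>C. \<forall>y\<ge>0. \<bar>D (Suc j) y\<bar> \<le> C * exp (- y)" for j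
      by (simp add: D_def poly_times_gauss_bound)
    show "\<exists>L. (D j \<longlongrightarrow> L) at_top" for j
    proof (cases j)
      case 0
      with L show ?thesis by (auto simp: D_def)
    next
      case (Suc i)
      obtain C where C: "\<And>y. y \<ge> 0 \<Longrightarrow> \<bar>D j y\<bar> \<le> C * exp (- y)"
        using bound Suc by blast
      have "((\<lambda>y. C * exp (- y)) \<longlongrightarrow> 0) at_top"
        by real_asymp
      then have "(D j \<longlongrightarrow> 0) at_top"
        by (rule Lim_null_comparison[rotated])
          (use C in \<open>auto intro: eventually_at_top_linorderI[of 0]\<close>)
      then show ?thesis by blast
    qed
  qed (rule assms)
  show ?thesis
    using poly_asymp_riemann_sum[of M 0] by (simp add: D_def)
qed

section \<open>Gaussian sums weighted by inverse even powers\<close>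

lemma exists_antiderivative_poly: "\<exists>P. pderiv P = (p :: real poly)"
proof
  have "pderiv (\<Sum>i\<le>degree p. monom (coeff p i / real (Suc i)) (Suc i)) = (\<Sum>i\<le>degree p. monom (coeff p i) i)"
    by (simp add: higher_pderiv_sum[of 1, simplified] smult_monom pderiv_monom del: of_nat_Suc)
  then show "pderiv (\<Sum>i\<le>degree p. monom (coeff p i / real (Suc i)) (Suc i)) = p"
    by (simp add: poly_as_sum_of_monoms)
qed

text \<open>These are the sums \<open>S\<^sub>k h\<close> of the overview. For positive
  \<open>k\<close> the value at \<open>h = 0\<close> is the Hurwitz zeta value at
  \<open>2 * k\<close>.\<close>

definition gauss_zeta :: "real \<Rightarrow> nat \<Rightarrow> real \<Rightarrow> real" where
  "gauss_zeta a k h = (\<Sum>n. inverse ((real n + a)\<^sup>2) ^ k * exp (- (h * (real n + a))\<^sup>2))"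

context
  fixes a :: real
  assumes a: "a > 0"
begin

lemma inverse_square_bounds:
  "0 < inverse ((real n + a)\<^sup>2)" "inverse ((real n + a)\<^sup>2) \<le> inverse (a\<^sup>2)"
  using a by (auto intro!: le_imp_inverse_le power_mono simp: add_nonneg_pos)

lemma summable_inverse_square: "summable (\<lambda>n. inverse ((real n + a)\<^sup>2))"
proof (rule summable_comparison_test'[OF inverse_power_summable[of 2], where N = 1])
  fix n :: nat assume "n \<ge> 1"
  then show "norm (inverse ((real n + a)\<^sup>2)) \<le> inverse ((real n)\<^sup>2)"
    using a by (auto intro!: le_imp_inverse_le power_mono)
qed simp

lemma summable_gauss:
  assumes "h > 0"
  shows "summable (\<lambda>n. exp (- (h * (real n + a))\<^sup>2))"
proof (rule summable_comparison_test'[OF summable_mult[of _ "exp 1",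
        OF sum_exp_arith_progression(1)[OF less_imp_le[OF a] assms]]])
  fix n :: nat
  show "norm (exp (- (h * (real n + a))\<^sup>2)) \<le> exp 1 * exp (- (h * (real n + a)))"
    using minus_square_le[of "h * (real n + a)"] by (simp flip: exp_add)
qed

lemma summable_bounded_mult_gauss:
  fixes w :: "nat \<Rightarrow> 'a::{real_normed_field,banach}"
  assumes "h > 0" "\<And>n. norm (w n) \<le> C"
  shows "summable (\<lambda>n. w n * of_real (exp (- (h * (real n + a))\<^sup>2)))"
  by (rule summable_comparison_test'[OF summable_mult[of _ C, OF summable_gauss[OF assms(1)]]])
    (use assms(2) in \<open>auto simp: norm_mult intro: mult_right_mono\<close>)

lemma inverse_square_power_le: "inverse ((real n + a)\<^sup>2) ^ k \<le> inverse (a\<^sup>2) ^ k"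
  using inverse_square_bounds by (intro power_mono) (auto simp: less_imp_le)

lemma summable_gauss_zeta:
  assumes "h > 0"
  shows "summable (\<lambda>n. inverse ((real n + a)\<^sup>2) ^ k * exp (- (h * (real n + a))\<^sup>2))"
  using summable_bounded_mult_gauss[of h "\<lambda>n. inverse ((real n + a)\<^sup>2) ^ k" "inverse (a\<^sup>2) ^ k"]
    assms inverse_square_power_le by simp

text \<open>Differentiating a term brings down \<open>- 2 * h * (real n + a)\<^sup>2\<close>, which
  cancels one inverse square.\<close>

lemma deriv_gauss_zeta:
  assumes h: "h > 0"
  shows "(gauss_zeta a (Suc k) has_real_derivative - 2 * (h * gauss_zeta a k h)) (at h)"
proof -
  \<comment> \<open>On this neighbourhood of h, bounded away from 0, the Gaussian at
    \<open>h / 2\<close> dominates and \<open>2 * x\<close> is at most \<open>4 * h\<close>.\<close>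
  define S where "S = {h / 2<..<2 * h}"
  define f' where "f' n x = - 2 * x * (inverse ((real n + a)\<^sup>2) ^ k * exp (- (x * (real n + a))\<^sup>2))"
    for n x
  have "((\<lambda>x. \<Sum>n. inverse ((real n + a)\<^sup>2) ^ Suc k * exp (- (x * (real n + a))\<^sup>2))
      has_real_derivative (\<Sum>n. f' n h)) (at h)"
  proof (rule has_field_derivative_series')
    show "((\<lambda>x. inverse ((real n + a)\<^sup>2) ^ Suc k * exp (- (x * (real n + a))\<^sup>2))
        has_real_derivative f' n x) (at x within S)" for n x
    proof -
      define c where "c = real n + a"
      have "c \<noteq> 0" using a by (simp add: c_def add_nonneg_eq_0_iff)
      then have "inverse (c\<^sup>2) ^ Suc k * (- 2 * x * c\<^sup>2 * exp (- (x * c)\<^sup>2))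
          = - 2 * x * (inverse (c\<^sup>2) ^ k * exp (- (x * c)\<^sup>2))"
        by simp
      moreover have "((\<lambda>x. exp (- (x * c)\<^sup>2)) has_real_derivative
          - 2 * x * c\<^sup>2 * exp (- (x * c)\<^sup>2)) (at x within S)"
        by (auto intro!: derivative_eq_intros simp: power2_eq_square)
      then have "((\<lambda>x. inverse (c\<^sup>2) ^ Suc k * exp (- (x * c)\<^sup>2)) has_real_derivative
          inverse (c\<^sup>2) ^ Suc k * (- 2 * x * c\<^sup>2 * exp (- (x * c)\<^sup>2))) (at x within S)"
        by (rule DERIV_cmult)
      ultimately show ?thesis
        unfolding f'_def c_def[symmetric] by metis
    qed
    show "uniformly_convergent_on S (\<lambda>n x. \<Sum>i<n. f' i x)"
    proof (rule Weierstrass_m_test')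
      show "summable (\<lambda>n. 4 * h * (inverse ((real n + a)\<^sup>2) ^ k * exp (- (h / 2 * (real n + a))\<^sup>2)))"
        using h by (intro summable_mult summable_gauss_zeta) simp
      fix n x assume x: "x \<in> S"
      have "(h / 2 * (real n + a))\<^sup>2 \<le> (x * (real n + a))\<^sup>2"
        using x a h by (intro power_mono mult_right_mono) (auto simp: S_def)
      then have "2 * x * (inverse ((real n + a)\<^sup>2) ^ k * exp (- (x * (real n + a))\<^sup>2))
        \<le> 4 * h * (inverse ((real n + a)\<^sup>2) ^ k * exp (- (h / 2 * (real n + a))\<^sup>2))"
        using x h by (intro mult_mono[of "2 * x"] mult_left_mono) (auto simp: S_def)
      then show "norm (f' n x)
        \<le> 4 * h * (inverse ((real n + a)\<^sup>2) ^ k * exp (- (h / 2 * (real n + a))\<^sup>2))"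
        using x h by (simp add: f'_def abs_mult S_def)
    qed
  qed (use h summable_gauss_zeta[OF h, of "Suc k"] in
      \<open>auto simp: S_def interior_open convex_real_interval\<close>)
  then show ?thesis
    using suminf_mult[OF summable_gauss_zeta[OF h, of k], of "- 2 * h"]
    by (simp add: gauss_zeta_def[abs_def] f'_def mult_ac)
qed

text \<open>With at least one inverse square the series has a summable majorant independent of h, so
  continuity includes \<open>h = 0\<close>, where the integration below starts.\<close>

lemma continuous_gauss_zeta: "continuous_on S (gauss_zeta a (Suc k))"
proof -
  have "uniform_limit S
      (\<lambda>N x. \<Sum>n<N. inverse ((real n + a)\<^sup>2) ^ Suc k * exp (- (x * (real n + a))\<^sup>2))
      (gauss_zeta a (Suc k)) sequentially"
    unfolding gauss_zeta_def
  proof (rule Weierstrass_m_test)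
    show "summable (\<lambda>n. inverse (a\<^sup>2) ^ k * inverse ((real n + a)\<^sup>2))"
      by (intro summable_mult summable_inverse_square)
    fix n x
    have "inverse ((real n + a)\<^sup>2) ^ k * inverse ((real n + a)\<^sup>2) * exp (- (x * (real n + a))\<^sup>2)
      \<le> inverse (a\<^sup>2) ^ k * inverse ((real n + a)\<^sup>2) * 1"
      by (intro mult_mono inverse_square_power_le) auto
    then show "norm (inverse ((real n + a)\<^sup>2) ^ Suc k * exp (- (x * (real n + a))\<^sup>2))
      \<le> inverse (a\<^sup>2) ^ k * inverse ((real n + a)\<^sup>2)"
      by (simp add: mult_ac abs_mult)
  qed
  then show ?thesis
    by (rule uniform_limit_theorem[rotated]) (auto intro!: always_eventually continuous_intros)
qed

text \<open>The derivative of the next sum is \<open>- 2\<close> times the function expanded in the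
  induction hypothesis. Integrating its polynomial part and its remainder from 0 gives the
  expansion, with a gain of one order.\<close>

lemma poly_asymp_gauss_zeta: "poly_asymp M (\<lambda>h. h * gauss_zeta a k h)"
proof (induction k arbitrary: M)
  case 0
  show ?case
    using poly_asymp_gauss_sum[OF a, of M] by (simp add: gauss_zeta_def)
next
  case (Suc k)
  obtain p where "(\<lambda>h. h * gauss_zeta a k h - poly p h) \<in> O[at_right 0](\<lambda>h. h ^ M)"
    using Suc.IH[of M] unfolding poly_asymp_def by auto
  then obtain C where "\<forall>\<^sub>F h in at_right 0. norm (h * gauss_zeta a k h - poly p h) \<le> C * norm (h ^ M)"
    by (elim landau_o.bigE)
  then obtain b where b: "b > 0"
    and C: "\<And>h. 0 < h \<Longrightarrow> h < b \<Longrightarrow> \<bar>h * gauss_zeta a k h - poly p h\<bar> \<le> C * h ^ M"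
    unfolding eventually_at_right_field by (auto simp: power_abs)
  have "0 \<le> C"
  proof -
    have "0 \<le> C * (b / 2) ^ M"
      using C[of "b / 2"] b by (smt (verit) field_sum_of_halves)
    moreover have "0 < (b / 2) ^ M"
      using b by simp
    ultimately show ?thesis
      by (smt (verit) mult_neg_pos)
  qed
  obtain P where P: "pderiv P = p"
    using exists_antiderivative_poly by blast
  \<comment> \<open>Adding \<open>2 * poly P h\<close> cancels the polynomial part of the
    derivative, so that \<Phi> has derivative of order \<open>h ^ M\<close>. By the mean value
    theorem \<Phi> is constant up to order \<open>Suc M\<close>.\<close>
  define \<Phi> where "\<Phi> h = gauss_zeta a (Suc k) h + 2 * poly P h" for h
  have "\<bar>\<Phi> h - \<Phi> 0\<bar> \<le> 2 * C * h ^ Suc M" if h: "0 < h" "h < b" for h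
  proof -
    have deriv: "(\<Phi> has_real_derivative - 2 * (x * gauss_zeta a k x - poly p x)) (at x)"
      if "x > 0" for x
      unfolding \<Phi>_def
      by (auto intro!: derivative_eq_intros deriv_gauss_zeta[OF that] poly_DERIV simp: P algebra_simps)
    have "\<exists>l z. 0 < z \<and> z < h \<and> DERIV \<Phi> z :> l \<and> \<Phi> h - \<Phi> 0 = (h - 0) * l"
    proof (rule MVT[OF h(1)])
      show "continuous_on {0..h} \<Phi>"
        unfolding \<Phi>_def by (intro continuous_intros continuous_gauss_zeta)
      show "\<Phi> differentiable at x" if "0 < x" for x
        using deriv[OF that] real_differentiable_def by blast
    qed
    then obtain z where z: "0 < z" "z < h"
      and eq: "\<Phi> h - \<Phi> 0 = h * (- 2 * (z * gauss_zeta a k z - poly p z))"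
      using deriv DERIV_unique by fastforce
    have "\<bar>z * gauss_zeta a k z - poly p z\<bar> \<le> C * z ^ M"
      using C z h by simp
    also have "\<dots> \<le> C * h ^ M"
      using z \<open>0 \<le> C\<close> by (intro mult_left_mono power_mono) auto
    finally show ?thesis
      using h unfolding eq by (simp add: abs_mult mult_ac)
  qed
  then have "(\<lambda>h. \<Phi> h - \<Phi> 0) \<in> O[at_right 0](\<lambda>h. h ^ Suc M)"
    by (intro bigoI[of _ "2 * C"] eventually_at_rightI[of 0 b]) (use b in \<open>auto simp: abs_mult\<close>)
  then have "poly_asymp (Suc M) (gauss_zeta a (Suc k))"
    unfolding poly_asymp_def
    by (intro exI[of _ "[:\<Phi> 0:] - smult 2 P"]) (simp add: \<Phi>_def algebra_simps)
  from poly_asymp_mult_power[OF this, of 1 1] show ?case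
    by (auto intro: poly_asymp_mono)
qed

end

subsection \<open>Perturbed Gaussian sums\<close>

text \<open>The Lagrange remainder carries \<open>exp (- t)\<close> with t positive, hence at most
  1. The absence of a growing factor matters because y will be \<open>h\<^sup>2 * x n\<close>, which
  is unbounded in n.\<close>

lemma exp_minus_taylor_bound:
  fixes y :: real
  assumes "y \<ge> 0"
  shows "\<bar>exp (- y) - (\<Sum>i<M. (- y) ^ i / fact i)\<bar> \<le> y ^ M"
proof (cases "M = 0 \<or> y = 0")
  case True
  then show ?thesis
    using assms by (cases M) (auto simp: sum.lessThan_Suc_shift simp del: sum.lessThan_Suc)
next
  case False
  then have "\<exists>t. (if y < 0 then y < t \<and> t < 0 else 0 < t \<and> t < y) \<and>
      exp (- y) = (\<Sum>i<M. (- 1) ^ i * exp (- 0) / fact i * (y - 0) ^ i)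
        + (- 1) ^ M * exp (- t) / fact M * (y - 0) ^ M"
    using assms
    by (intro Taylor[of M "\<lambda>i t. (- 1) ^ i * exp (- t)" "\<lambda>t. exp (- t)" 0 y])
      (auto intro!: derivative_eq_intros)
  then obtain t where t: "0 < t"
    and eq: "exp (- y) = (\<Sum>i<M. (- 1) ^ i / fact i * y ^ i) + (- 1) ^ M * exp (- t) / fact M * y ^ M"
    using False assms by (auto split: if_splits)
  have "(- 1) ^ i / fact i * y ^ i = (- y) ^ i / fact i" for i
    by (simp add: power_minus[of y])
  then have "exp (- y) - (\<Sum>i<M. (- y) ^ i / fact i) = (- 1) ^ M * exp (- t) / fact M * y ^ M"
    using eq by simp
  also have "\<bar>\<dots>\<bar> = exp (- t) / fact M * y ^ M"
    using assms by (simp add: abs_mult power_abs)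
  also have "\<dots> \<le> 1 / 1 * y ^ M"
    using t assms by (intro mult_right_mono frac_le) (auto simp: fact_ge_1)
  finally show ?thesis by simp
qed

text \<open>This version serves complex arguments; they will stay bounded, so the factor
  \<open>exp (norm z)\<close> is harmless there.\<close>

lemma exp_taylor_bound:
  fixes z :: "'a::{banach,real_normed_field}"
  shows "norm (exp z - (\<Sum>i<M. z ^ i / fact i)) \<le> exp (norm z) * norm z ^ M"
proof (cases M)
  case 0
  then show ?thesis by (simp add: norm_exp)
next
  case (Suc n)
  have "norm (exp z - (\<Sum>i\<le>n. z ^ i / fact i)) \<le> exp (norm z) * norm z ^ Suc n / fact n"
    by (rule Taylor_exp_field)
  also have "\<dots> \<le> exp (norm z) * norm z ^ Suc n / 1"
    by (intro divide_left_mono) (auto simp: fact_ge_1)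
  finally show ?thesis
    by (simp add: Suc lessThan_Suc_atMost)
qed

text \<open>Splitting off \<open>r 0\<close> and dividing by z leaves a removable singularity. The
  factorisation thus holds on all of \<open>U\<close>, not merely on a disc about 0, which the
  interval of sample points may leave.\<close>

lemma holomorphic_taylor_factor:
  assumes "open U" "0 \<in> U" "g holomorphic_on U"
  shows "\<exists>P r. r holomorphic_on U \<and> (\<forall>z\<in>U. g z = poly P z + z ^ K * r z)"
proof (induction K)
  case 0
  show ?case
    using assms(3) by (intro exI[of _ 0] exI[of _ g]) simp
next
  case (Suc K)
  then obtain P r where r: "r holomorphic_on U"
    and g: "\<And>z. z \<in> U \<Longrightarrow> g z = poly P z + z ^ K * r z"
    by blast
  define s where "s z = (if z = 0 then deriv r 0 else (r z - r 0) / (z - 0))" for z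
  have "s holomorphic_on U"
    unfolding s_def by (rule pole_lemma) (use r assms in \<open>auto simp: interior_open\<close>)
  moreover
  have r_eq: "r z = r 0 + z * s z" for z
    by (simp add: s_def)
  have "g z = poly (P + monom (r 0) K) z + z ^ Suc K * s z" if "z \<in> U" for z
    unfolding g[OF that] r_eq[of z] by (simp add: poly_monom algebra_simps)
  ultimately show ?case
    by (intro exI[of _ "P + monom (r 0) K"] exI[of _ s]) simp
qed

section \<open>Holomorphic weights and the perturbed exponential\<close>

context
  fixes a :: real
  assumes a: "a > 0"
begin

abbreviation inv_sq :: "nat \<Rightarrow> real" where
  "inv_sq n \<equiv> inverse ((real n + a)\<^sup>2)"

abbreviation gauss_term :: "real \<Rightarrow> nat \<Rightarrow> real" where
  "gauss_term h n \<equiv> exp (- (h * (real n + a))\<^sup>2)"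

text \<open>The Gaussian is expanded in powers of \<open>h\<^sup>2 * x n\<close> up to order
  \<open>M\<close>. The weights decay fast enough to absorb up to \<open>M\<close> factors
  \<open>x n\<close> and still leave one inverse square for absolute convergence.\<close>

lemma poly_asymp_decaying_weights:
  fixes w :: "nat \<Rightarrow> complex"
  assumes w: "\<And>n. norm (w n) \<le> C * inv_sq n ^ Suc M"
  shows "poly_asymp M (\<lambda>h. of_real h * (\<Sum>n. w n * of_real (gauss_term h n)))"
proof -
  define x where "x n = (real n + a)\<^sup>2" for n
  have x: "x n > 0" "inv_sq n = inverse (x n)" for n
    using a by (simp_all add: x_def add_nonneg_pos)
  have "0 \<le> C"
  proof -
    have "0 \<le> C * inv_sq 0 ^ Suc M"
      using w[of 0] norm_ge_zero order_trans by blast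
    moreover have "0 < inv_sq 0 ^ Suc M" using a by simp
    ultimately show ?thesis by (smt (verit) mult_neg_pos)
  qed
  have sum_u: "summable inv_sq"
    by (rule summable_inverse_square[OF a])
  have summable: "summable (\<lambda>n. w n * of_real (- x n) ^ i / fact i)" if "i < M" for i
  proof (rule summable_comparison_test'[OF summable_mult[OF sum_u]])
    fix n :: nat
    have "norm (w n * of_real (- x n) ^ i / fact i) = norm (w n) * x n ^ i / fact i"
      using x(1)[of n] by (simp add: norm_mult norm_divide norm_power)
    also have "\<dots> \<le> norm (w n) * x n ^ i / 1"
      using x(1)[of n] by (intro divide_left_mono) (auto simp: fact_ge_1)
    also have "\<dots> \<le> C * (inv_sq n ^ Suc M * x n ^ i)"
      using mult_right_mono[OF w[of n], of "x n ^ i"] x(1)[of n] by (simp add: mult.assoc)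
    finally have norm_le: "norm (w n * of_real (- x n) ^ i / fact i) \<le> C * (inv_sq n ^ Suc M * x n ^ i)" .
    \<comment> \<open>Of the \<open>Suc M\<close> inverse squares, i cancel the powers of
      \<open>x n\<close>, one gives summability, and the other \<open>M - i\<close> are bounded by
      their value at \<open>n = 0\<close>.\<close>
    have "inv_sq n ^ Suc M * x n ^ i = inv_sq n ^ (M - i) * inv_sq n * (inv_sq n * x n) ^ i"
      using that by (simp add: power_mult_distrib flip: power_add)
    also have "\<dots> = inv_sq n ^ (M - i) * inv_sq n"
      using x(1)[of n] by (simp add: x(2))
    also have "\<dots> \<le> inv_sq 0 ^ (M - i) * inv_sq n"
      using inverse_square_power_le[OF a, of n] x[of n] by (intro mult_right_mono) auto
    finally have "C * (inv_sq n ^ Suc M * x n ^ i) \<le> C * (inv_sq 0 ^ (M - i) * inv_sq n)"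
      using \<open>0 \<le> C\<close> by (rule mult_left_mono)
    with norm_le show "norm (w n * of_real (- x n) ^ i / fact i) \<le> (C * inv_sq 0 ^ (M - i)) * inv_sq n"
      by (simp only: mult.assoc)
  qed
  define p where "p = (\<Sum>i<M. monom (\<Sum>n. w n * of_real (- x n) ^ i / fact i) (2 * i))"
  have bound: "norm ((\<Sum>n. w n * of_real (gauss_term h n)) - poly p (of_real h)) \<le> (C * suminf inv_sq) * h ^ M"
    if h: "0 < h" "h \<le> 1" for h
  proof -
    have gauss: "gauss_term h n = exp (- (h\<^sup>2 * x n))" for n
      by (simp add: x_def power_mult_distrib)
    have norm_w: "norm (w n) \<le> C * inv_sq 0 ^ Suc M" for n
      using w[of n] mult_left_mono[OF inverse_square_power_le[OF a, of n "Suc M"] \<open>0 \<le> C\<close>]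
      by simp
    have 1: "(\<lambda>n. w n * of_real (gauss_term h n)) sums (\<Sum>n. w n * of_real (gauss_term h n))"
      by (intro summable_sums summable_bounded_mult_gauss[OF a h(1) norm_w])
    have 2: "(\<lambda>n. \<Sum>i<M. of_real h ^ (2 * i) * (w n * of_real (- x n) ^ i / fact i)) sums
        (\<Sum>i<M. of_real h ^ (2 * i) * (\<Sum>n. w n * of_real (- x n) ^ i / fact i))"
      by (intro sums_sum sums_mult summable_sums summable) auto
    have p: "poly p (of_real h)
        = (\<Sum>i<M. of_real h ^ (2 * i) * (\<Sum>n. w n * of_real (- x n) ^ i / fact i))"
      by (simp add: p_def poly_sum poly_monom mult.commute)
    have eq: "w n * of_real (gauss_term h n)
        - (\<Sum>i<M. of_real h ^ (2 * i) * (w n * of_real (- x n) ^ i / fact i))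
        = w n * of_real (exp (- (h\<^sup>2 * x n)) - (\<Sum>i<M. (- (h\<^sup>2 * x n)) ^ i / fact i))" for n
    proof -
      have "of_real h ^ (2 * i) * (w n * of_real (- x n) ^ i / fact i)
          = w n * of_real ((- (h\<^sup>2 * x n)) ^ i / fact i)" for i
      proof -
        have "(- (h\<^sup>2 * x n)) ^ i = h ^ (2 * i) * (- x n) ^ i"
          by (metis mult_minus_right power_mult power_mult_distrib)
        then show ?thesis by simp
      qed
      then show ?thesis
        by (simp only: gauss of_real_diff of_real_sum right_diff_distrib sum_distrib_left)
    qed
    have "norm (\<Sum>n. w n * of_real (exp (- (h\<^sup>2 * x n)) - (\<Sum>i<M. (- (h\<^sup>2 * x n)) ^ i / fact i)))
        \<le> (\<Sum>n. C * h ^ (2 * M) * inv_sq n)"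
    proof (rule norm_suminf_le)
      fix n
      have "norm (w n * of_real (exp (- (h\<^sup>2 * x n)) - (\<Sum>i<M. (- (h\<^sup>2 * x n)) ^ i / fact i)))
          \<le> (C * inv_sq n ^ Suc M) * (h\<^sup>2 * x n) ^ M"
        unfolding norm_mult norm_of_real
        using w[of n] exp_minus_taylor_bound[of "h\<^sup>2 * x n" M] x(1)[of n] \<open>0 \<le> C\<close>
        by (intro mult_mono) auto
      also have "\<dots> = C * h ^ (2 * M) * inv_sq n * (inv_sq n * x n) ^ M"
        unfolding power_mult_distrib power_mult by (simp add: mult_ac del: power_inverse)
      also have "\<dots> = C * h ^ (2 * M) * inv_sq n"
        using x(1)[of n] by (simp add: x(2))
      finally show "norm (w n * of_real (exp (- (h\<^sup>2 * x n)) - (\<Sum>i<M. (- (h\<^sup>2 * x n)) ^ i / fact i)))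
          \<le> C * h ^ (2 * M) * inv_sq n" .
    qed (intro summable_mult sum_u)
    also have "\<dots> = C * h ^ (2 * M) * suminf inv_sq"
      by (rule suminf_mult[OF sum_u])
    \<comment> \<open>For h at most 1 the order \<open>2 * M\<close> of the remainder may be lowered
      to \<open>M\<close>.\<close>
    also have "\<dots> \<le> C * h ^ M * suminf inv_sq"
      using h \<open>0 \<le> C\<close> x
      by (intro mult_right_mono mult_left_mono power_decreasing suminf_nonneg sum_u)
        (auto simp: less_imp_le)
    finally show ?thesis
      using sums_diff[OF 1 2] unfolding eq p by (simp add: sums_iff mult_ac)
  qed
  have "poly_asymp M (\<lambda>h. \<Sum>n. w n * of_real (gauss_term h n))"
    unfolding poly_asymp_def
    by (intro exI[of _ p] bounded_at_right_0_bigo[of _ "C * suminf inv_sq"] bound)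
  from poly_asymp_mult_power[OF this, of 1 1] show ?thesis
    by (auto intro: poly_asymp_mono)
qed

text \<open>The Taylor polynomial of \<open>g\<close> at 0 contributes a combination of the sums
  \<open>gauss_zeta a i h\<close>; the remaining factor \<open>r\<close> is bounded on the compact
  interval, so the rest has decaying weights.\<close>

lemma poly_asymp_holomorphic_weights:
  assumes U: "open U" "complex_of_real ` {0..inverse (a\<^sup>2)} \<subseteq> U"
    and g: "g holomorphic_on U"
  shows "poly_asymp M (\<lambda>h. of_real h * (\<Sum>n. g (of_real (inv_sq n)) * of_real (gauss_term h n)))"
proof -
  have "0 \<in> U"
    using U(2) by (force simp: image_subset_iff)
  then obtain P r where r: "r holomorphic_on U"
    and eq: "\<And>z. z \<in> U \<Longrightarrow> g z = poly P z + z ^ Suc M * r z"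
    using holomorphic_taylor_factor[OF U(1) _ g] by meson
  have mem: "complex_of_real (inv_sq n) \<in> complex_of_real ` {0..inverse (a\<^sup>2)}" for n
    using inverse_square_bounds[OF a, of n] by (intro imageI) auto
  have "compact (complex_of_real ` {0..inverse (a\<^sup>2)})"
    by (intro compact_continuous_image continuous_intros) auto
  moreover have "continuous_on (complex_of_real ` {0..inverse (a\<^sup>2)}) r"
    using holomorphic_on_imp_continuous_on[OF r] U(2) continuous_on_subset by blast
  ultimately have "bounded (r ` complex_of_real ` {0..inverse (a\<^sup>2)})"
    using compact_continuous_image compact_imp_bounded by blast
  then obtain C where C: "\<And>n. norm (r (of_real (inv_sq n))) \<le> C"
    using mem unfolding bounded_iff by blast
  define w where "w n = of_real (inv_sq n) ^ Suc M * r (of_real (inv_sq n))" for n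
  have w: "norm (w n) \<le> C * inv_sq n ^ Suc M" for n
  proof -
    have "norm (w n) = inv_sq n ^ Suc M * norm (r (of_real (inv_sq n)))"
      unfolding w_def norm_mult norm_power norm_of_real by simp
    also have "\<dots> \<le> inv_sq n ^ Suc M * C"
      by (intro mult_left_mono C) simp
    finally show ?thesis by (simp only: mult.commute)
  qed
  have "poly_asymp M (\<lambda>h. (\<Sum>i\<le>degree P. coeff P i * of_real h ^ 0 * of_real (h * gauss_zeta a i h))
      + of_real h * (\<Sum>n. w n * of_real (gauss_term h n)))"
    using poly_asymp_mult_power[OF poly_asymp_of_real[OF poly_asymp_gauss_zeta[OF a]], where k = 0]
    by (intro poly_asymp_add poly_asymp_sum poly_asymp_decaying_weights[OF w]) simp
  then show ?thesis
  proof (rule poly_asymp_cong)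
    fix h :: real assume h: "h > 0"
    have "(\<lambda>n. \<Sum>i\<le>degree P. coeff P i * of_real (inv_sq n ^ i * gauss_term h n)) sums
        (\<Sum>i\<le>degree P. coeff P i * of_real (gauss_zeta a i h))"
      unfolding gauss_zeta_def
      by (intro sums_sum sums_mult sums_of_real summable_sums summable_gauss_zeta[OF a h])
    moreover have "norm (w n) \<le> C * inv_sq 0 ^ Suc M" for n
    proof -
      have "0 \<le> C" using C[of 0] norm_ge_zero order_trans by blast
      then show ?thesis
        using w[of n] mult_left_mono[OF inverse_square_power_le[OF a, of n "Suc M"], of C] by simp
    qed
    then have "(\<lambda>n. w n * of_real (gauss_term h n)) sums (\<Sum>n. w n * of_real (gauss_term h n))"
      by (intro summable_sums summable_bounded_mult_gauss[OF a h])
    ultimately have "(\<lambda>n. (\<Sum>i\<le>degree P. coeff P i * of_real (inv_sq n ^ i * gauss_term h n))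
        + w n * of_real (gauss_term h n)) sums
        ((\<Sum>i\<le>degree P. coeff P i * of_real (gauss_zeta a i h)) + (\<Sum>n. w n * of_real (gauss_term h n)))"
      by (rule sums_add)
    moreover have "g (of_real (inv_sq n)) * of_real (gauss_term h n)
        = (\<Sum>i\<le>degree P. coeff P i * of_real (inv_sq n ^ i * gauss_term h n)) + w n * of_real (gauss_term h n)" for n
    proof -
      have "complex_of_real (inv_sq n) \<in> U" using mem U(2) by blast
      from eq[OF this] show ?thesis
        unfolding w_def poly_altdef by (simp add: algebra_simps sum_distrib_left)
    qed
    ultimately have "(\<lambda>n. g (of_real (inv_sq n)) * of_real (gauss_term h n)) sums
        ((\<Sum>i\<le>degree P. coeff P i * of_real (gauss_zeta a i h)) + (\<Sum>n. w n * of_real (gauss_term h n)))"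
      by simp
    then show "(\<Sum>i\<le>degree P. coeff P i * of_real h ^ 0 * of_real (h * gauss_zeta a i h))
        + of_real h * (\<Sum>n. w n * of_real (gauss_term h n))
        = of_real h * (\<Sum>n. g (of_real (inv_sq n)) * of_real (gauss_term h n))"
      by (simp add: sums_iff distrib_left sum_distrib_left mult_ac)
  qed
qed

text \<open>The factor \<open>exp (- h\<^sup>2 q)\<close> is expanded uniformly in n, as
  \<open>q\<close> is bounded at the sample points. Each term is a Gaussian sum weighted by a power
  of \<open>q\<close>, which is again holomorphic.\<close>

lemma poly_asymp_perturbed_gauss:
  assumes U: "open U" "complex_of_real ` {0..inverse (a\<^sup>2)} \<subseteq> U"
    and q: "q holomorphic_on U" and B: "\<And>n. norm (q (of_real (inv_sq n))) \<le> B"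
  shows "poly_asymp M (\<lambda>h. of_real h *
    (\<Sum>n. exp (- of_real (h\<^sup>2) * q (of_real (inv_sq n))) * of_real (gauss_term h n)))"
proof -
  define v where "v n = q (of_real (inv_sq n))" for n
  have "0 \<le> B"
    using B[of 0] norm_ge_zero order_trans by blast
  define \<rho> where "\<rho> h n = exp (- of_real (h\<^sup>2) * v n) - (\<Sum>i<M. (- of_real (h\<^sup>2) * v n) ^ i / fact i)"
    for h n
  have \<rho>: "norm (\<rho> h n) \<le> exp B * B ^ M * h ^ M" if h: "0 < h" "h \<le> 1" for h n
  proof -
    define y where "y = norm (- of_real (h\<^sup>2) * v n)"
    have y: "y \<le> h\<^sup>2 * B" "0 \<le> y"
      using B[of n] by (auto simp: y_def v_def norm_mult norm_power intro: mult_left_mono)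
    \<comment> \<open>The first inequality produces the factor \<open>h ^ M\<close>, the second
      bounds the exponential by \<open>exp B\<close>.\<close>
    have "h\<^sup>2 \<le> h" "h\<^sup>2 \<le> 1"
      using h by (simp_all add: power2_eq_square mult_left_le power_le_one mult_le_one)
    then have "y \<le> h * B" "y \<le> B"
      using y(1) \<open>0 \<le> B\<close> mult_right_mono[of "h\<^sup>2" h B] mult_right_mono[of "h\<^sup>2" 1 B] by auto
    then have "exp y * y ^ M \<le> exp B * (h * B) ^ M"
      using y(2) by (intro mult_mono power_mono) auto
    then show ?thesis
      using exp_taylor_bound[of "- of_real (h\<^sup>2) * v n" M]
      by (simp add: \<rho>_def y_def power_mult_distrib mult_ac)
  qed
  have rest: "(\<lambda>h. of_real h * (\<Sum>n. \<rho> h n * of_real (gauss_term h n))) \<in> O[at_right 0](\<lambda>h. of_real h ^ M)"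
  proof -
    \<comment> \<open>The plain Gaussian sum grows at most like \<open>1 / h\<close>, so the outer
      factor h keeps the uniform bound on \<rho> intact.\<close>
    have "(\<lambda>h. h * gauss_zeta a 0 h) \<in> O[at_right 0](\<lambda>_. 1)"
    proof -
      obtain p where p: "(\<lambda>h. h * gauss_zeta a 0 h - poly p h) \<in> O[at_right 0](\<lambda>_. 1)"
        using poly_asymp_gauss_zeta[OF a, of 0 0] unfolding poly_asymp_def by auto
      from sum_in_bigo(1)[OF p poly_minus_truncation_bigo[of p 0, simplified]] show ?thesis
        by simp
    qed
    from landau_o.big.mult[OF landau_o.big_refl this, of "\<lambda>h. h ^ M"]
    have "(\<lambda>h. complex_of_real (h ^ M * (h * gauss_zeta a 0 h))) \<in> O[at_right 0](\<lambda>h. of_real (h ^ M))"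
      by (subst landau_o.big.of_real_iff) (simp only: mult_1_right)
    moreover have "(\<lambda>h. of_real h * (\<Sum>n. \<rho> h n * of_real (gauss_term h n)))
        \<in> O[at_right 0](\<lambda>h. of_real (h ^ M * (h * gauss_zeta a 0 h)))"
    proof (rule bigoI[of _ "exp B * B ^ M"], rule eventually_at_rightI[of 0 1])
      fix h :: real assume "h \<in> {0<..<1}"
      then have h: "0 < h" "h \<le> 1" by auto
      have nonneg: "0 \<le> gauss_zeta a 0 h"
        unfolding gauss_zeta_def by (intro suminf_nonneg summable_gauss_zeta a h) auto
      have "norm (\<Sum>n. \<rho> h n * of_real (gauss_term h n))
          \<le> (\<Sum>n. exp B * B ^ M * h ^ M * (inv_sq n ^ 0 * gauss_term h n))"
        using \<rho>[OF h]
        by (intro norm_suminf_le summable_mult summable_gauss_zeta[OF a h(1)])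
          (simp add: norm_mult mult.assoc)
      also have "\<dots> = exp B * B ^ M * h ^ M * gauss_zeta a 0 h"
        unfolding gauss_zeta_def by (rule suminf_mult[OF summable_gauss_zeta[OF a h(1)]])
      finally show "norm (of_real h * (\<Sum>n. \<rho> h n * of_real (gauss_term h n)))
          \<le> exp B * B ^ M * norm (complex_of_real (h ^ M * (h * gauss_zeta a 0 h)))"
        using h nonneg
        by (simp add: norm_mult norm_power mult_left_mono mult.left_commute)
    qed simp
    ultimately show ?thesis
      unfolding of_real_power by (rule landau_o.big_trans[rotated])
  qed
  have "poly_asymp M (\<lambda>h. of_real h * (\<Sum>n. v n ^ i * of_real (gauss_term h n)))" for i
    using poly_asymp_holomorphic_weights[OF U holomorphic_on_power[OF q], of M i]
    by (simp add: v_def)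
  then have "poly_asymp M (\<lambda>h. (- 1) ^ i / fact i * of_real h ^ (2 * i)
      * (of_real h * (\<Sum>n. v n ^ i * of_real (gauss_term h n))))" for i
    by (rule poly_asymp_mono[OF poly_asymp_mult_power]) simp
  then have "poly_asymp M (\<lambda>h. (\<Sum>i<M. (- 1) ^ i / fact i * of_real h ^ (2 * i)
      * (of_real h * (\<Sum>n. v n ^ i * of_real (gauss_term h n))))
      + of_real h * (\<Sum>n. \<rho> h n * of_real (gauss_term h n)))"
    by (intro poly_asymp_add poly_asymp_sum poly_asymp_bigo[OF rest])
  then show ?thesis
    unfolding v_def[symmetric]
  proof (rule poly_asymp_cong)
    fix h :: real assume h: "h > 0"
    have s1: "(\<lambda>n. v n ^ i * of_real (gauss_term h n)) sums (\<Sum>n. v n ^ i * of_real (gauss_term h n))" for i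
      using B by (intro summable_sums summable_bounded_mult_gauss[OF a h, of _ "B ^ i"])
        (simp add: norm_power v_def power_mono)
    have "norm (exp (- of_real (h\<^sup>2) * v n)) \<le> exp (h\<^sup>2 * B)" for n
    proof -
      have "norm (exp (- of_real (h\<^sup>2) * v n)) \<le> exp (norm (- of_real (h\<^sup>2) * v n))"
        by (rule norm_exp)
      also have "\<dots> \<le> exp (h\<^sup>2 * B)"
        using B[of n] by (simp add: v_def norm_mult norm_power mult_left_mono)
      finally show ?thesis .
    qed
    then have s2: "(\<lambda>n. exp (- of_real (h\<^sup>2) * v n) * of_real (gauss_term h n)) sums
        (\<Sum>n. exp (- of_real (h\<^sup>2) * v n) * of_real (gauss_term h n))"
      by (intro summable_sums summable_bounded_mult_gauss[OF a h])
    have s3: "(\<lambda>n. \<Sum>i<M. (- 1) ^ i / fact i * of_real h ^ (2 * i) * (v n ^ i * of_real (gauss_term h n))) sums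
        (\<Sum>i<M. (- 1) ^ i / fact i * of_real h ^ (2 * i) * (\<Sum>n. v n ^ i * of_real (gauss_term h n)))"
      by (intro sums_sum sums_mult s1)
    have term_eq: "(- of_real (h\<^sup>2) * v n) ^ i / fact i = (- 1) ^ i / fact i * of_real h ^ (2 * i) * v n ^ i"
      for n i
      by (simp add: power_mult_distrib power_mult power_minus[of "_ * _"] power_minus[of "of_real h ^ 2"])
    have "\<rho> h n * of_real (gauss_term h n) = exp (- of_real (h\<^sup>2) * v n) * of_real (gauss_term h n)
        - (\<Sum>i<M. (- 1) ^ i / fact i * of_real h ^ (2 * i) * (v n ^ i * of_real (gauss_term h n)))" for n
      unfolding \<rho>_def term_eq left_diff_distrib sum_distrib_right by (simp only: mult.assoc)
    with sums_diff[OF s2 s3] have "(\<lambda>n. \<rho> h n * of_real (gauss_term h n)) sums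
        ((\<Sum>n. exp (- of_real (h\<^sup>2) * v n) * of_real (gauss_term h n))
        - (\<Sum>i<M. (- 1) ^ i / fact i * of_real h ^ (2 * i) * (\<Sum>n. v n ^ i * of_real (gauss_term h n))))"
      by simp
    then have "(\<Sum>n. \<rho> h n * of_real (gauss_term h n)) =
        (\<Sum>n. exp (- of_real (h\<^sup>2) * v n) * of_real (gauss_term h n))
        - (\<Sum>i<M. (- 1) ^ i / fact i * of_real h ^ (2 * i) * (\<Sum>n. v n ^ i * of_real (gauss_term h n)))"
      by (rule sums_unique[symmetric])
    then show "(\<Sum>i<M. (- 1) ^ i / fact i * of_real h ^ (2 * i)
        * (of_real h * (\<Sum>n. v n ^ i * of_real (gauss_term h n))))
        + of_real h * (\<Sum>n. \<rho> h n * of_real (gauss_term h n))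
        = of_real h * (\<Sum>n. exp (- of_real (h\<^sup>2) * v n) * of_real (gauss_term h n))"
      by (simp only: right_diff_distrib sum_distrib_left mult.left_commute[of "of_real h"]) simp
  qed
qed

end

subsection \<open>Admissibility\<close>

text \<open>Substituting \<open>h = sqrt t\<close> and dividing by h turns \<open>h ^ \<nu>\<close>
  into t to the power \<open>(\<nu> - 1) / 2\<close>.\<close>

lemma power_expansion_of_sqrt:
  fixes f :: "real \<Rightarrow> complex"
  assumes "\<And>M. poly_asymp M (\<lambda>h. of_real h * f (h\<^sup>2))"
  shows "\<exists>c. power_expansion_at_0 f c (\<lambda>\<nu>. (real \<nu> - 1) / 2)"
proof -
  obtain c where c: "\<And>N. (\<lambda>h. of_real h * f (h\<^sup>2) - (\<Sum>\<nu><N. c \<nu> * of_real h ^ \<nu>))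
      \<in> O[at_right 0](\<lambda>h. of_real h ^ N)"
    using poly_asymp_imp_coefficients[OF assms] by blast
  have sqrt_lim: "filterlim sqrt (at_right 0) (at_right 0)"
    by real_asymp
  have "(\<lambda>t. f t - (\<Sum>\<nu>\<le>N. c \<nu> * of_real (t powr ((real \<nu> - 1) / 2))))
      \<in> o[at_right 0](\<lambda>t. of_real (t powr ((real N - 1) / 2)))" for N
  proof -
    have powr: "complex_of_real (t powr ((real \<nu> - 1) / 2)) = inverse (of_real (sqrt t)) * of_real (sqrt t) ^ \<nu>"
      if "t > 0" for t :: real and \<nu> :: nat
    proof -
      have "t powr ((real \<nu> - 1) / 2) = (sqrt t) powr (real \<nu> - 1)"
        using that by (simp add: powr_half_sqrt[symmetric] powr_powr)
      also have "\<dots> = inverse (sqrt t) * sqrt t ^ \<nu>"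
        using that by (simp add: powr_diff powr_realpow field_simps)
      finally show ?thesis by simp
    qed
    have "(\<lambda>t. of_real (sqrt t) * f ((sqrt t)\<^sup>2) - (\<Sum>\<nu><Suc N. c \<nu> * of_real (sqrt t) ^ \<nu>))
        \<in> O[at_right 0](\<lambda>t. of_real (sqrt t) ^ Suc N)"
      by (rule landau_o.big.compose[OF c sqrt_lim])
    \<comment> \<open>The truncation includes the term of index \<open>N\<close>, so its error has
      order \<open>Suc N\<close> in \<open>sqrt t\<close> and is negligible against that last
      term.\<close>
    moreover have "(\<lambda>t. complex_of_real (sqrt t) ^ Suc N) \<in> o[at_right 0](\<lambda>t. of_real (sqrt t) ^ N)"
    proof -
      have "((\<lambda>t. complex_of_real (sqrt t)) \<longlongrightarrow> of_real (sqrt 0)) (at_right 0)"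
        by (intro tendsto_intros)
      then have "(\<lambda>t. complex_of_real (sqrt t)) \<in> o[at_right 0](\<lambda>_. 1)"
        by (intro smalloI_tendsto) auto
      from landau_o.small_big_mult[OF this landau_o.big_refl, of "\<lambda>t. of_real (sqrt t) ^ N"]
      show ?thesis by (simp only: power_Suc mult_1_left)
    qed
    ultimately have small: "(\<lambda>t. of_real (sqrt t) * f ((sqrt t)\<^sup>2) - (\<Sum>\<nu><Suc N. c \<nu> * of_real (sqrt t) ^ \<nu>))
        \<in> o[at_right 0](\<lambda>t. of_real (sqrt t) ^ N)"
      by (rule landau_o.big_small_trans)
    have "(\<lambda>t. inverse (of_real (sqrt t))
          * (of_real (sqrt t) * f ((sqrt t)\<^sup>2) - (\<Sum>\<nu><Suc N. c \<nu> * of_real (sqrt t) ^ \<nu>)))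
        \<in> o[at_right 0](\<lambda>t. inverse (of_real (sqrt t)) * of_real (sqrt t) ^ N)"
      by (rule landau_o.big_small_mult[OF landau_o.big_refl small])
    moreover have "\<forall>\<^sub>F t in at_right 0. inverse (of_real (sqrt t))
          * (of_real (sqrt t) * f ((sqrt t)\<^sup>2) - (\<Sum>\<nu><Suc N. c \<nu> * of_real (sqrt t) ^ \<nu>))
        = f t - (\<Sum>\<nu>\<le>N. c \<nu> * of_real (t powr ((real \<nu> - 1) / 2)))"
      using eventually_at_right_less
    proof (eventually_elim)
      case (elim t)
      define s where "s = complex_of_real (sqrt t)"
      have "s \<noteq> 0" "(sqrt t)\<^sup>2 = t"
        using elim by (simp_all add: s_def)
      then show ?case
        unfolding powr[OF elim] s_def[symmetric] lessThan_Suc_atMost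
        by (simp add: right_diff_distrib sum_distrib_left mult.left_commute flip: mult.assoc)
    qed
    moreover have "\<forall>\<^sub>F t in at_right 0. inverse (of_real (sqrt t)) * of_real (sqrt t) ^ N
        = complex_of_real (t powr ((real N - 1) / 2))"
      using eventually_at_right_less by eventually_elim (simp only: powr)
    ultimately show ?thesis
      by (rule landau_o.small.cong_ex[THEN iffD1, rotated 2])
  qed
  moreover have "strict_mono (\<lambda>\<nu>. (real \<nu> - 1) / 2)"
    by (auto intro!: strict_monoI)
  moreover have "filterlim (\<lambda>\<nu>. (real \<nu> - 1) / 2) at_top sequentially"
    by real_asymp
  ultimately show ?thesis
    unfolding power_expansion_at_0_def by blast
qed

theorem theorem1p4:
  fixes a :: real and q :: "complex \<Rightarrow> complex" and U :: "complex set"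
    and lam :: "nat \<Rightarrow> complex"
  assumes "a > 0"
    and "open U" and "complex_of_real ` {0..a powi (-2)} \<subseteq> U" and "q analytic_on U"
    and "\<And>n. lam n = of_real ((real n + a)^2) + q (of_real ((real n + a) powi (-2)))"
    and "\<And>n. lam n \<in> \<real> \<and> Re (lam n) > 0"
  shows "QHS_admissible lam"
proof -
  note a = assms(1)
  have U: "complex_of_real ` {0..inverse (a\<^sup>2)} \<subseteq> U"
    using assms(3) by (simp add: power_int_minus)
  have q: "q holomorphic_on U"
    using assms(4) by (rule analytic_imp_holomorphic)
  have lam: "lam n = of_real ((real n + a)\<^sup>2) + q (of_real (inv_sq a n))" for n
    unfolding assms(5) by (simp add: power_int_minus)
  have "compact (complex_of_real ` {0..inverse (a\<^sup>2)})"
    by (intro compact_continuous_image continuous_intros) auto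
  moreover have "continuous_on (complex_of_real ` {0..inverse (a\<^sup>2)}) q"
    using holomorphic_on_imp_continuous_on[OF q] U continuous_on_subset by blast
  ultimately have "bounded (q ` complex_of_real ` {0..inverse (a\<^sup>2)})"
    using compact_continuous_image compact_imp_bounded by blast
  moreover have "complex_of_real (inv_sq a n) \<in> complex_of_real ` {0..inverse (a\<^sup>2)}" for n
    using inverse_square_bounds[OF a, of n] by (intro imageI) auto
  ultimately obtain B where B: "\<And>n. norm (q (of_real (inv_sq a n))) \<le> B"
    unfolding bounded_iff by blast
  \<comment> \<open>At \<open>t = h\<^sup>2\<close> a term of the theta series splits into the
    perturbation and the Gaussian.\<close>
  have exp_lam: "exp (- lam n * of_real (h\<^sup>2)) = exp (- of_real (h\<^sup>2) * q (of_real (inv_sq a n))) * of_real (gauss_term a h n)"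
    for n h
  proof -
    have "complex_of_real (- (h * (real n + a))\<^sup>2) = - (of_real ((real n + a)\<^sup>2) * of_real (h\<^sup>2))"
      by (simp only: power_mult_distrib of_real_minus of_real_mult mult.commute)
    moreover have "- (x + y) * z = - z * y + - (x * z)" for x y z :: complex
      by (simp add: algebra_simps)
    ultimately have "- lam n * of_real (h\<^sup>2)
        = - of_real (h\<^sup>2) * q (of_real (inv_sq a n)) + of_real (- (h * (real n + a))\<^sup>2)"
      unfolding lam by simp
    then show ?thesis
      by (simp only: exp_add exp_of_real)
  qed
  define \<theta> where "\<theta> t = (\<Sum>k. exp (- lam k * of_real t))" for t
  have asymp: "poly_asymp M (\<lambda>h. of_real h * \<theta> (h\<^sup>2))" for M
    unfolding \<theta>_def exp_lam by (rule poly_asymp_perturbed_gauss[OF a assms(2) U q B])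
  have summable: "summable (\<lambda>k. norm (exp (- lam k * of_real t)))" if "t > 0" for t
  proof -
    define h where "h = sqrt t"
    have h: "h > 0" "t = h\<^sup>2" using that by (simp_all add: h_def)
    have "norm (norm (exp (- of_real (h\<^sup>2) * q (of_real (inv_sq a n))))) \<le> exp (h\<^sup>2 * B)" for n
    proof -
      have "norm (exp (- of_real (h\<^sup>2) * q (of_real (inv_sq a n))))
          \<le> exp (norm (- of_real (h\<^sup>2) * q (of_real (inv_sq a n))))"
        by (rule norm_exp)
      also have "\<dots> \<le> exp (h\<^sup>2 * B)"
        using mult_left_mono[OF B[of n], of "h\<^sup>2"] unfolding norm_mult norm_minus_cancel norm_of_real by simp
      finally show ?thesis by simp
    qed
    from summable_bounded_mult_gauss[OF a h(1) this] show ?thesis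
      unfolding h(2) exp_lam norm_mult norm_of_real by simp
  qed
  \<comment> \<open>Since every \<open>lam k\<close> is a positive real, it equals its norm, and the
    third condition concerns \<theta> itself.\<close>
  have norm_sum: "(\<Sum>k. exp (- norm (lam k) * t)) = norm (\<theta> t)" if "t > 0" for t
  proof -
    have eq: "exp (- lam k * of_real t) = of_real (exp (- norm (lam k) * t))" for k
    proof -
      obtain x where x: "lam k = of_real x" "x > 0"
        using assms(6)[of k] by (auto elim!: Reals_cases)
      then show ?thesis by (simp flip: exp_of_real)
    qed
    have "summable (\<lambda>k. exp (- norm (lam k) * t))"
      using summable[OF that] unfolding eq by simp
    then have "\<theta> t = of_real (\<Sum>k. exp (- norm (lam k) * t))"
      and "0 \<le> (\<Sum>k. exp (- norm (lam k) * t))"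
      unfolding \<theta>_def eq by (auto simp: suminf_of_real suminf_nonneg)
    then show ?thesis by simp
  qed
  \<comment> \<open>The expansion truncated at order 0 says that \<open>sqrt t * \<theta> t\<close>
    is bounded. One more factor \<open>sqrt t\<close> sends the product to 0, so
    \<open>\<beta> = 1\<close> is a witness.\<close>
  have "(\<lambda>h. of_real h * \<theta> (h\<^sup>2)) \<in> O[at_right 0](\<lambda>_. 1)"
    using poly_asymp_imp_coefficients[OF asymp] by (metis (no_types, lifting) lessThan_0 sum.empty diff_zero power_0 ext)
  then have "(\<lambda>t. of_real (sqrt t) * \<theta> ((sqrt t)\<^sup>2)) \<in> O[at_right 0](\<lambda>_. 1)"
    by (rule landau_o.big.compose) real_asymp
  moreover have "((\<lambda>t. complex_of_real (sqrt t)) \<longlongrightarrow> of_real (sqrt 0)) (at_right 0)"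
    by (intro tendsto_intros)
  then have "(\<lambda>t. complex_of_real (sqrt t)) \<in> o[at_right 0](\<lambda>_. 1)"
    by (intro smalloI_tendsto) auto
  ultimately have "(\<lambda>t. of_real (sqrt t) * (of_real (sqrt t) * \<theta> ((sqrt t)\<^sup>2))) \<in> o[at_right 0](\<lambda>_. 1 * 1)"
    by (intro landau_o.small_big_mult)
  then have "((\<lambda>t. of_real (sqrt t) * (of_real (sqrt t) * \<theta> ((sqrt t)\<^sup>2))) \<longlongrightarrow> 0) (at_right 0)"
    by (auto dest: smalloD_tendsto)
  then have "((\<lambda>t. norm (of_real (sqrt t) * (of_real (sqrt t) * \<theta> ((sqrt t)\<^sup>2)))) \<longlongrightarrow> 0) (at_right 0)"
    by (rule tendsto_norm_zero)
  moreover have "\<forall>\<^sub>F t in at_right 0. norm (of_real (sqrt t) * (of_real (sqrt t) * \<theta> ((sqrt t)\<^sup>2)))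
      = t powr 1 * (\<Sum>k. exp (- norm (lam k) * t))"
    using eventually_at_right_less
  proof eventually_elim
    case (elim t)
    then show ?case
      using norm_sum[OF elim] by (simp add: norm_mult flip: mult.assoc)
  qed
  ultimately have "((\<lambda>t. t powr 1 * (\<Sum>k. exp (- norm (lam k) * t))) \<longlongrightarrow> 0) (at_right 0)"
    by (rule Lim_transform_eventually)
  moreover have "Re (lam k) > 0" "lam k \<noteq> 0" for k
    using assms(6)[of k] by auto
  ultimately show ?thesis
    using summable power_expansion_of_sqrt[OF asymp]
    unfolding QHS_admissible_def \<theta>_def by (intro conjI) (blast intro: zero_less_one)+
qed

end
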